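(* Consider any system of PDEs $F_\alpha(x,u^{(s)},\widetilde u^{(s)})=0$, $\alpha=1,\ldots,m$, in $n$ independent variables and $m+\widetilde m$ dependent variables $(u,\widetilde u)$, together with its adjoint equations $F^\star_\alpha=0$ $(\alpha=1,\ldots,m)$ and $\widetilde F^\star_{\widetilde\alpha}=0$ $(\widetilde\alpha=1,\ldots,\widetilde m)$. This combined system, in the $2(m+\widetilde m)$ unknowns $(u,\widetilde u,v,\widetilde v)$, has a Lagrangian. Namely, the combined system is the system of Euler--Lagrange equations of the Lagrangian $$L=\sum_{\beta=1}^m v^\beta F_\beta+\Big(\sum_{\widetilde\beta=1}^{\widetilde m}\widetilde v^{\widetilde\beta}\Big)\Big(\sum_{\nu=1}^m F_\nu\Big),$$ i.e. the equations $\frac{\delta L}{\delta u^\alpha}=0$, $\frac{\delta L}{\delta \widetilde u^{\widetilde\alpha}}=0$, $\frac{\delta L}{\delta v^\alpha}=0$, $\frac{\delta L}{\delta\widetilde v^{\widetilde\alpha}}=0$ $(\alpha=1,\ldots,m,\ \widetilde\alpha=1,\ldots,\widetilde m)$ are equivalent to the equations $F_\alpha=0$, $F^\star_\alpha=0$, $\widetilde F^\star_{\widetilde\alpha}=0$.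
   Context: Independent variables: $x=(x^1,\ldots,x^n)$. Dependent variables: $u=(u^1,\ldots,u^m)$ and $\widetilde u=(\widetilde u^1,\ldots,\widetilde u^{\widetilde m})$, functions of $x$. The number of equations $m$ is less than or equal to the number $m+\widetilde m$ of dependent variables ($\widetilde m\ge 0$; empty sums are $0$). $u^{(s)}$ denotes the tuple of the $u^j$ and all their partial derivatives up to order $s$; similarly $\widetilde u^{(s)}$. A differential function is a smooth function of $x$ and finitely many derivatives of the dependent variables; the $F_\alpha$ are differential functions. $D_{x^i}$ is the total derivative with respect to $x^i$. For a dependent variable $z$, the variational derivative is $\frac{\delta}{\delta z}=\sum_J(-1)^{|J|}D_J\frac{\partial}{\partial z_J}$, where $J=(j_1,\ldots,j_n)$ runs over multi-indices, $D_J=D_{x^1}^{j_1}\cdots D_{x^n}^{j_n}$ and $z_J=\partial^{|J|}z/\partial (x^1)^{j_1}\cdots\partial(x^n)^{j_n}$. Adjoint equations: introduce new dependent variables $v=(v^1,\ldots,v^m)$ and $\widetilde v=(\widetilde v^1,\ldots,\widetilde v^{\widetilde m})$, functions of $x$, and set $$F^\star_\alpha=\frac{\delta}{\delta u^\alpha}\Big[\sum_{\beta=1}^m v^\beta F_\beta+\Big(\sum_{\widetilde\beta=1}^{\widetilde m}\widetilde v^{\widetilde\beta}\Big)\Big(\sum_{\nu=1}^m F_\nu\Big)\Big],\qquad \widetilde F^\star_{\widetilde\alpha}=\frac{\delta}{\delta\widetilde u^{\widetilde\alpha}}\Big[\sum_{\beta=1}^m v^\beta F_\beta+\Big(\sum_{\widetilde\beta=1}^{\widetilde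 m}\widetilde v^{\widetilde\beta}\Big)\Big(\sum_{\nu=1}^m F_\nu\Big)\Big].$$ The adjoint equations are $F^\star_\alpha=0$ for $\alpha=1,\ldots,m$ and $\widetilde F^\star_{\widetilde\alpha}=0$ for $\widetilde\alpha=1,\ldots,\widetilde m$. *)

theory Defs
  imports "HOL-Analysis.Analysis" "HOL-Library.Groups_Big_Fun"
begin

section \<open>Smooth functions of coordinates\<close>

text \<open>
  Functions of coordinates indexed by an arbitrary type \<open>'c\<close> are functions on \<open>'c \<Rightarrow> real\<close>,
  which carries the product topology. For a finite type \<open>'n\<close>, \<open>'n \<Rightarrow> real\<close> is Euclidean space;
  jet space (below) has infinitely many coordinates, but differential functions
  depend on finitely many of them only.
\<close>

definition pd :: "'c \<Rightarrow> (('c \<Rightarrow> real) \<Rightarrow> real) \<Rightarrow> ('c \<Rightarrow> real) \<Rightarrow> real" where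
  "pd c f p = deriv (\<lambda>t. f (p(c := t))) (p c)"

primrec Ck_on :: "nat \<Rightarrow> ('c \<Rightarrow> real) set \<Rightarrow> (('c \<Rightarrow> real) \<Rightarrow> real) \<Rightarrow> bool" where
  "Ck_on 0 S f \<longleftrightarrow> continuous_on S f"
| "Ck_on (Suc k) S f \<longleftrightarrow> continuous_on S f \<and>
     (\<forall>c. (\<forall>p\<in>S. (\<lambda>t. f (p(c := t))) field_differentiable (at (p c))) \<and> Ck_on k S (pd c f))"

definition smooth_on :: "('c \<Rightarrow> real) set \<Rightarrow> (('c \<Rightarrow> real) \<Rightarrow> real) \<Rightarrow> bool" where
  "smooth_on S f \<longleftrightarrow> (\<forall>k. Ck_on k S f)"

text \<open>\<open>op_power T J\<close> is the composition of the \<open>T i ^^ J i\<close>, taken in the order of the indices.\<close>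

definition op_power :: "('n::{finite,linorder} \<Rightarrow> 'f \<Rightarrow> 'f) \<Rightarrow> ('n \<Rightarrow> nat) \<Rightarrow> 'f \<Rightarrow> 'f" where
  "op_power T J = foldr (\<lambda>i. T i ^^ J i) (sorted_list_of_set UNIV)"


section \<open>Jet space and differential functions\<close>

text \<open>
  \<open>U j\<close>, \<open>Ut j\<close>, \<open>V j\<close>, \<open>Vt j\<close> are the j-th components of u, u-tilde, v, v-tilde. Their index
  ranges \<open>{1..m}\<close> and \<open>{1..mt}\<close> are imposed where the symbols are used (\<open>mt = 0\<close> has to be
  possible). Independent variables are indexed by the finite linearly ordered type \<open>'n\<close>,
  multi-indices are functions \<open>'n \<Rightarrow> nat\<close>. A point of jet space assigns a value to each
  independent variable and to each derivative of a dependent variable.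
\<close>

datatype dvar = U nat | Ut nat | V nat | Vt nat

datatype 'n coord = X 'n | Jet dvar "'n \<Rightarrow> nat"

type_synonym 'n jet = "'n coord \<Rightarrow> real"
type_synonym 'n jetfun = "'n jet \<Rightarrow> real"

definition mi_size :: "('n::finite \<Rightarrow> nat) \<Rightarrow> nat" where
  "mi_size J = (\<Sum>i\<in>UNIV. J i)"

definition jet_coords :: "dvar set \<Rightarrow> nat \<Rightarrow> 'n::finite coord set" where
  "jet_coords Z s = range X \<union> {Jet z J | z J. z \<in> Z \<and> mi_size J \<le> s}"

text \<open>
  Differential functions of order at most \<open>s\<close> in the dependent variables \<open>Z\<close>. They are defined
  on an open set \<open>D\<close> of jets, which is \<open>UNIV\<close> for functions defined everywhere; a general \<open>D\<close>
  admits expressions such as \<open>ln u\<close> or \<open>1 / u\<close>.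
\<close>

definition differential_function ::
    "'n::finite jet set \<Rightarrow> dvar set \<Rightarrow> nat \<Rightarrow> 'n jetfun \<Rightarrow> bool" where
  "differential_function D Z s f \<longleftrightarrow> smooth_on D f \<and>
     (\<forall>p\<in>D. \<forall>q\<in>D. (\<forall>c\<in>jet_coords Z s. p c = q c) \<longrightarrow> f p = f q)"

text \<open>
  For a differential function only finitely many summands below are nonzero;
  \<open>Sum_any\<close> is the sum over these.
\<close>

definition total_deriv :: "'n \<Rightarrow> 'n jetfun \<Rightarrow> 'n jetfun" where
  "total_deriv i f p = pd (X i) f p +
     Sum_any (\<lambda>(z, J). p (Jet z (J(i := Suc (J i)))) * pd (Jet z J) f p)"

definition var_deriv :: "dvar \<Rightarrow> 'n::{finite,linorder} jetfun \<Rightarrow> 'n jetfun" where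
  "var_deriv z f p =
     Sum_any (\<lambda>J. (- 1) ^ mi_size J * op_power total_deriv J (pd (Jet z J) f) p)"


section \<open>Systems of differential equations\<close>

text \<open>A set \<open>E\<close> of differential functions represents the system \<open>e = 0\<close>, for all \<open>e \<in> E\<close>.\<close>

definition prolong ::
    "(dvar \<Rightarrow> ('n::{finite,linorder} \<Rightarrow> real) \<Rightarrow> real) \<Rightarrow> ('n \<Rightarrow> real) \<Rightarrow> 'n jet" where
  "prolong w x c = (case c of X i \<Rightarrow> x i | Jet z J \<Rightarrow> op_power pd J (w z) x)"

definition is_solution ::
    "'n::{finite,linorder} jet set \<Rightarrow> dvar set \<Rightarrow> 'n jetfun set \<Rightarrow> ('n \<Rightarrow> real) set \<Rightarrow>
     (dvar \<Rightarrow> ('n \<Rightarrow> real) \<Rightarrow> real) \<Rightarrow> bool" where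
  "is_solution D Z E \<Omega> w \<longleftrightarrow> open \<Omega> \<and> (\<forall>z\<in>Z. smooth_on \<Omega> (w z)) \<and>
     (\<forall>x\<in>\<Omega>. prolong w x \<in> D \<and> (\<forall>e\<in>E. e (prolong w x) = 0))"

text \<open>
  Equivalence of systems, both as systems of equations between the jet coordinates and
  as differential equations, i.e. in terms of their solutions.
\<close>

definition equivalent_systems ::
    "'n::{finite,linorder} jet set \<Rightarrow> dvar set \<Rightarrow> 'n jetfun set \<Rightarrow> 'n jetfun set \<Rightarrow> bool" where
  "equivalent_systems D Z E E' \<longleftrightarrow>
     (\<forall>p\<in>D. (\<forall>e\<in>E. e p = 0) \<longleftrightarrow> (\<forall>e\<in>E'. e p = 0)) \<and>
     (\<forall>\<Omega> w. is_solution D Z E \<Omega> w \<longleftrightarrow> is_solution D Z E' \<Omega> w)"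

definition euler_lagrange :: "dvar set \<Rightarrow> 'n::{finite,linorder} jetfun \<Rightarrow> 'n jetfun set" where
  "euler_lagrange Z L = {var_deriv z L | z. z \<in> Z}"

definition is_lagrangian_of ::
    "'n::{finite,linorder} jet set \<Rightarrow> dvar set \<Rightarrow> 'n jetfun \<Rightarrow> 'n jetfun set \<Rightarrow> bool" where
  "is_lagrangian_of D Z L E \<longleftrightarrow>
     (\<exists>s. differential_function D Z s L) \<and> equivalent_systems D Z (euler_lagrange Z L) E"


section \<open>Adjoint equations\<close>

definition orig_vars :: "nat \<Rightarrow> nat \<Rightarrow> dvar set" where
  "orig_vars m mt = U ` {1..m} \<union> Ut ` {1..mt}"

definition adj_vars :: "nat \<Rightarrow> nat \<Rightarrow> dvar set" where
  "adj_vars m mt = V ` {1..m} \<union> Vt ` {1..mt}"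

abbreviation val :: "dvar \<Rightarrow> 'n jetfun" where
  "val z p \<equiv> p (Jet z (\<lambda>_. 0))"

definition formal_lagrangian :: "nat \<Rightarrow> nat \<Rightarrow> (nat \<Rightarrow> 'n jetfun) \<Rightarrow> 'n jetfun" where
  "formal_lagrangian m mt F p =
     (\<Sum>\<beta>=1..m. val (V \<beta>) p * F \<beta> p) + (\<Sum>\<beta>=1..mt. val (Vt \<beta>) p) * (\<Sum>\<nu>=1..m. F \<nu> p)"

definition adj_F ::
    "nat \<Rightarrow> nat \<Rightarrow> (nat \<Rightarrow> 'n::{finite,linorder} jetfun) \<Rightarrow> nat \<Rightarrow> 'n jetfun" where
  "adj_F m mt F \<alpha> = var_deriv (U \<alpha>) (formal_lagrangian m mt F)"

definition adj_Ft ::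
    "nat \<Rightarrow> nat \<Rightarrow> (nat \<Rightarrow> 'n::{finite,linorder} jetfun) \<Rightarrow> nat \<Rightarrow> 'n jetfun" where
  "adj_Ft m mt F \<alpha> = var_deriv (Ut \<alpha>) (formal_lagrangian m mt F)"

definition combined_system ::
    "nat \<Rightarrow> nat \<Rightarrow> (nat \<Rightarrow> 'n::{finite,linorder} jetfun) \<Rightarrow> 'n jetfun set" where
  "combined_system m mt F = F ` {1..m} \<union> adj_F m mt F ` {1..m} \<union> adj_Ft m mt F ` {1..mt}"

end

theory Submission
  imports Defs
begin

text \<open>
  The equations for u and u-tilde agree by the definition of the adjoint system. The
  new variables enter \<open>L\<close> linearly and without derivatives, and the \<open>F \<nu>\<close> do not depend on
  them, so the variational derivative of \<open>L\<close> by \<open>V \<alpha>\<close> is \<open>F \<alpha>\<close>, while the one by \<open>Vt \<alpha>\<close> is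
  the sum of all \<open>F \<nu>\<close> and hence gives no new equation. The hypotheses control the \<open>F \<nu>\<close> only
  on the open set \<open>D\<close>, but all identities are local: a function vanishing on \<open>D\<close> has total
  derivatives vanishing on \<open>D\<close>.
\<close>

section \<open>Partial derivatives on open sets\<close>

lemma isCont_fun_upd:
  fixes p :: "'c \<Rightarrow> real"
  shows "isCont (\<lambda>t. p(c := t)) x"
proof -
  have "continuous_on UNIV (\<lambda>t. p(c := t))"
  proof (rule continuous_on_coordinatewise_then_product)
    fix i
    show "continuous_on UNIV (\<lambda>t. (p(c := t)) i)"
      by (cases "i = c") simp_all
  qed
  then show ?thesis
    by (simp add: continuous_on_eq_continuous_at)
qed

text \<open>The coordinate line through \<open>p\<close> is a continuous curve, so it stays in
  \<open>S\<close> for parameters near \<open>p c\<close>. This makes \<open>pd\<close> a local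
  operation on open sets.\<close>

lemma eventually_fun_upd_in_open:
  fixes p :: "'c \<Rightarrow> real"
  assumes "open S" "p \<in> S"
  shows "\<forall>\<^sub>F t in nhds (p c). p(c := t) \<in> S"
proof -
  have "((\<lambda>t. p(c := t)) \<longlongrightarrow> p(c := p c)) (nhds (p c))"
    unfolding tendsto_at_iff_tendsto_nhds[symmetric] using isCont_fun_upd by (simp only: isCont_def)
  then show ?thesis
    using assms by (simp add: topological_tendstoD)
qed

lemma pd_cong_open:
  assumes "open S" "p \<in> S" "\<And>q. q \<in> S \<Longrightarrow> f q = g q"
  shows "pd c f p = pd c g p"
  unfolding pd_def
  by (rule deriv_cong_ev)
    (auto intro: eventually_mono[OF eventually_fun_upd_in_open[OF assms(1,2)]] assms(3))

lemma pd_eq_0_open: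
  assumes "open S" "p \<in> S" "\<And>q. q \<in> S \<Longrightarrow> f q = 0"
  shows "pd c f p = 0"
  using pd_cong_open[OF assms(1,2), of f "\<lambda>_. 0" c] assms(3) by (simp add: pd_def)

section \<open>Smooth functions\<close>

text \<open>Equality on an open set passes to all partial derivatives there. This is needed because
  the sum and product rules for \<open>pd\<close> are available only at points of \<open>S\<close>,
  where differentiability is known.\<close>

lemma Ck_on_cong:
  assumes "open S" "\<And>p. p \<in> S \<Longrightarrow> f p = g p" "Ck_on k S f"
  shows "Ck_on k S g"
  using assms(2,3)
proof (induction k arbitrary: f g)
  case 0
  then show ?case
    by (simp cong: continuous_on_cong)
next
  case (Suc k)
  have "(\<lambda>t. g (p(c := t))) field_differentiable (at (p c))" if "p \<in> S" for p c
  proof -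
    have "\<forall>\<^sub>F t in nhds (p c). f (p(c := t)) = g (p(c := t))"
      using eventually_fun_upd_in_open[OF assms(1) that]
      by (rule eventually_mono) (rule Suc.prems(1))
    moreover have "(\<lambda>t. f (p(c := t))) field_differentiable (at (p c))"
      using Suc.prems(2) that by simp
    ultimately show ?thesis
      unfolding field_differentiable_def by (simp add: DERIV_cong_ev)
  qed
  moreover have "Ck_on k S (pd c g)" for c
    by (rule Suc.IH[of "pd c f"])
      (use Suc.prems in \<open>auto intro: pd_cong_open[OF assms(1)]\<close>)
  ultimately show ?case
    using Suc.prems by (simp cong: continuous_on_cong)
qed

lemma Ck_on_Suc_imp_Ck_on: "Ck_on (Suc k) S f \<Longrightarrow> Ck_on k S f"
proof (induction k arbitrary: f)
  case (Suc k)
  have "Ck_on k S (pd c f)" for c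
    using Suc.prems by (intro Suc.IH) simp
  then show ?case
    using Suc.prems by simp
qed simp

lemma Ck_on_const: "Ck_on k S (\<lambda>_. a)"
proof (induction k arbitrary: a)
  case (Suc k)
  have "pd c (\<lambda>_. a) = (\<lambda>_. 0)" for c :: 'a
    by (simp add: pd_def fun_eq_iff)
  with Suc show ?case
    by simp
qed simp

lemma DERIV_fun_upd_coord:
  fixes p :: "'c \<Rightarrow> real"
  shows "((\<lambda>t. (p(c := t)) d) has_real_derivative (if d = c then 1 else 0)) (at x)"
  by (cases "d = c") simp_all

text \<open>The first partial derivatives are the constants 0 and 1, so a case distinction on
  \<open>k\<close> replaces induction.\<close>

lemma Ck_on_coord: "Ck_on k S (\<lambda>p. p d)"
proof -
  have cont: "continuous_on S (\<lambda>p :: 'a \<Rightarrow> real. p d)"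
    by (rule continuous_on_subset[OF continuous_on_product_coordinates]) simp
  have "pd c (\<lambda>p. p d) = (\<lambda>_. if d = c then 1 else 0)" for c
    unfolding pd_def by (intro ext DERIV_imp_deriv DERIV_fun_upd_coord)
  moreover have "(\<lambda>t. (p(c := t)) d) field_differentiable (at (p c))" for p :: "'a \<Rightarrow> real" and c
    unfolding field_differentiable_def by (rule exI) (rule DERIV_fun_upd_coord)
  ultimately show ?thesis
    using cont by (cases k) (simp_all add: Ck_on_const del: fun_upd_apply)
qed

lemma Ck_on_add:
  assumes "open S" "Ck_on k S f" "Ck_on k S g"
  shows "Ck_on k S (\<lambda>p. f p + g p)"
  using assms(2,3)
proof (induction k arbitrary: f g)
  case 0
  then show ?case
    by (simp add: continuous_on_add)
next
  case (Suc k)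
  have diff: "(\<lambda>t. f (p(c := t))) field_differentiable (at (p c))"
    "(\<lambda>t. g (p(c := t))) field_differentiable (at (p c))" if "p \<in> S" for p c
    using Suc.prems that by auto
  have "Ck_on k S (pd c (\<lambda>p. f p + g p))" for c
  proof (rule Ck_on_cong[OF assms(1)])
    show "Ck_on k S (\<lambda>p. pd c f p + pd c g p)"
      using Suc by simp
    show "pd c f p + pd c g p = pd c (\<lambda>p. f p + g p) p" if "p \<in> S" for p
      using diff[OF that, of c] by (simp add: pd_def)
  qed
  then show ?case
    using Suc.prems diff by (simp add: continuous_on_add field_differentiable_add)
qed

lemma Ck_on_mult:
  assumes "open S" "Ck_on k S f" "Ck_on k S g"
  shows "Ck_on k S (\<lambda>p. f p * g p)"
  using assms(2,3)
proof (induction k arbitrary: f g)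
  case 0
  then show ?case
    by (simp add: continuous_on_mult)
next
  case (Suc k)
  have diff: "(\<lambda>t. f (p(c := t))) field_differentiable (at (p c))"
    "(\<lambda>t. g (p(c := t))) field_differentiable (at (p c))" if "p \<in> S" for p c
    using Suc.prems that by auto
  have "Ck_on k S (pd c (\<lambda>p. f p * g p))" for c
  proof (rule Ck_on_cong[OF assms(1)])
    \<comment> \<open>The product rule also contains the undifferentiated factors, whose regularity
      has to be lowered from \<open>Suc k\<close> to \<open>k\<close> before the induction
      hypothesis applies.\<close>
    show "Ck_on k S (\<lambda>p. f p * pd c g p + pd c f p * g p)"
      using Suc.prems Suc.prems[THEN Ck_on_Suc_imp_Ck_on]
      by (intro Ck_on_add[OF assms(1)] Suc.IH) simp_all
    show "f p * pd c g p + pd c f p * g p = pd c (\<lambda>p. f p * g p) p" if "p \<in> S" for p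
      using diff[OF that, of c] by (simp add: pd_def)
  qed
  then show ?case
    using Suc.prems diff by (simp add: continuous_on_mult field_differentiable_mult)
qed

lemma smooth_on_coord: "smooth_on S (\<lambda>p. p c)"
  by (simp add: smooth_on_def Ck_on_coord)

lemma smooth_on_add:
  "open S \<Longrightarrow> smooth_on S f \<Longrightarrow> smooth_on S g \<Longrightarrow> smooth_on S (\<lambda>p. f p + g p)"
  by (simp add: smooth_on_def Ck_on_add)

lemma smooth_on_mult:
  "open S \<Longrightarrow> smooth_on S f \<Longrightarrow> smooth_on S g \<Longrightarrow> smooth_on S (\<lambda>p. f p * g p)"
  by (simp add: smooth_on_def Ck_on_mult)

lemma smooth_on_sum:
  assumes "open S" "\<And>i. i \<in> I \<Longrightarrow> smooth_on S (f i)"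
  shows "smooth_on S (\<lambda>p. \<Sum>i\<in>I. f i p)"
  using assms(2)
proof (induction I rule: infinite_finite_induct)
  case (insert i I)
  then show ?case
    by (simp add: smooth_on_add assms(1))
qed (simp_all add: smooth_on_def Ck_on_const)

section \<open>Variational derivatives\<close>

lemma op_power_zero [simp]: "op_power T (\<lambda>_. 0) = id"
proof -
  have "foldr (\<lambda>i. T i ^^ 0) xs = id" for xs
    by (induction xs) (simp_all add: fun_eq_iff)
  then show ?thesis
    by (simp add: op_power_def)
qed

text \<open>All partial derivatives of \<open>f\<close> vanish on \<open>S\<close>, so every summand
  of the total derivative is zero.\<close>

lemma total_deriv_eq_0_open:
  assumes "open S" "p \<in> S" "\<And>q. q \<in> S \<Longrightarrow> f q = 0"
  shows "total_deriv i f p = 0"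
  unfolding total_deriv_def by (simp add: pd_eq_0_open[OF assms])

text \<open>This serves to carry the property of vanishing on an open set through iterated total
  derivatives.\<close>

lemma op_power_invariant:
  assumes "\<And>i f. P f \<Longrightarrow> P (T i f)" "P f"
  shows "P (op_power T J f)"
proof -
  have "P ((T i ^^ k) g)" if "P g" for i k g
    using that by (induction k) (simp_all add: assms(1))
  then have "P (foldr (\<lambda>i. T i ^^ J i) xs f)" for xs
    by (induction xs) (simp_all add: assms(2))
  then show ?thesis
    by (simp add: op_power_def)
qed

text \<open>The terms with nonzero \<open>J\<close> are iterated total derivatives of functions
  vanishing on \<open>S\<close>. The remaining term has sign 1 and contains no total
  derivative.\<close>

lemma var_deriv_eq_pd:
  assumes "open S" "p \<in> S"
    and "\<And>J q. J \<noteq> (\<lambda>_. 0) \<Longrightarrow> q \<in> S \<Longrightarrow> pd (Jet z J) f q = 0"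
  shows "var_deriv z f p = pd (Jet z (\<lambda>_. 0)) f p"
proof -
  have "op_power total_deriv J (pd (Jet z J) f) p = 0" if "J \<noteq> (\<lambda>_. 0)" for J
  proof -
    have "\<forall>q\<in>S. op_power total_deriv J (pd (Jet z J) f) q = 0"
      by (rule op_power_invariant[where P = "\<lambda>g. \<forall>q\<in>S. g q = 0"])
        (simp_all add: total_deriv_eq_0_open[OF assms(1)] assms(3)[OF that])
    then show ?thesis
      using assms(2) by simp
  qed
  \<comment> \<open>The term at the zero multi-index may vanish too, so the support is only known to
    be contained in this singleton.\<close>
  then have "var_deriv z f p = (\<Sum>J\<in>{\<lambda>_. 0}.
      (- 1) ^ mi_size J * op_power total_deriv J (pd (Jet z J) f) p)"
    unfolding var_deriv_def by (intro Sum_any.expand_superset) auto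
  then show ?thesis
    by (simp add: mi_size_def)
qed

section \<open>The formal Lagrangian\<close>

text \<open>Along a coordinate line belonging to \<open>z\<close> the \<open>F \<beta>\<close> stay
  constant near \<open>p\<close>, so the Lagrangian is affine there. The 0-1 factors are the
  derivatives of the coordinates of \<open>V \<beta>\<close> and \<open>Vt \<beta>\<close>.\<close>

lemma pd_formal_lagrangian:
  assumes "open D" "p \<in> D" "z \<notin> orig_vars m mt"
    and F: "\<And>\<alpha>. \<alpha> \<in> {1..m} \<Longrightarrow> differential_function D (orig_vars m mt) s (F \<alpha>)"
  shows "pd (Jet z J) (formal_lagrangian m mt F) p =
    (\<Sum>\<beta>=1..m. (if Jet (V \<beta>) (\<lambda>_. 0) = Jet z J then 1 else 0) * F \<beta> p) +
    (\<Sum>\<beta>=1..mt. if Jet (Vt \<beta>) (\<lambda>_. 0) = Jet z J then 1 else 0) * (\<Sum>\<nu>=1..m. F \<nu> p)"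
    (is "_ = ?R")
proof -
  let ?q = "\<lambda>t. p(Jet z J := t)"
  \<comment> \<open>\<open>?G\<close> freezes the \<open>F \<beta>\<close> at the base point
    \<open>p\<close>. It agrees with the Lagrangian only while the line remains in \<open>D\<close>,
    hence for parameters close to \<open>p (Jet z J)\<close>.\<close>
  let ?G = "\<lambda>t. (\<Sum>\<beta>=1..m. val (V \<beta>) (?q t) * F \<beta> p) +
    (\<Sum>\<beta>=1..mt. val (Vt \<beta>) (?q t)) * (\<Sum>\<nu>=1..m. F \<nu> p)"
  have "F \<alpha> (?q t) = F \<alpha> p" if "\<alpha> \<in> {1..m}" "?q t \<in> D" for \<alpha> t
  proof -
    have "\<forall>c\<in>jet_coords (orig_vars m mt) s. ?q t c = p c"
      using assms(3) by (auto simp: jet_coords_def)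
    then show ?thesis
      using F[OF that(1)] that(2) assms(2) unfolding differential_function_def by blast
  qed
  then have "\<forall>\<^sub>F t in nhds (p (Jet z J)). formal_lagrangian m mt F (?q t) = ?G t"
    unfolding formal_lagrangian_def
    by (intro eventually_mono[OF eventually_fun_upd_in_open[OF assms(1,2)]]) simp
  then have "pd (Jet z J) (formal_lagrangian m mt F) p = deriv ?G (p (Jet z J))"
    unfolding pd_def by (rule deriv_cong_ev) simp
  moreover have "(?G has_real_derivative ?R) (at (p (Jet z J)))"
    by (intro DERIV_add DERIV_cmult_right DERIV_sum DERIV_fun_upd_coord)
  ultimately show ?thesis
    by (simp only: DERIV_imp_deriv)
qed

lemma
  assumes "open D"
    and F: "\<And>\<alpha>. \<alpha> \<in> {1..m} \<Longrightarrow> differential_function D (orig_vars m mt) s (F \<alpha>)"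
    and "p \<in> D"
  shows var_deriv_V_formal_lagrangian:
      "\<alpha> \<in> {1..m} \<Longrightarrow> var_deriv (V \<alpha>) (formal_lagrangian m mt F) p = F \<alpha> p"
    and var_deriv_Vt_formal_lagrangian:
      "\<alpha> \<in> {1..mt} \<Longrightarrow> var_deriv (Vt \<alpha>) (formal_lagrangian m mt F) p = (\<Sum>\<nu>=1..m. F \<nu> p)"
proof -
  have orig: "V \<alpha> \<notin> orig_vars m mt" "Vt \<alpha> \<notin> orig_vars m mt"
    by (auto simp: orig_vars_def)
  note pd_L = pd_formal_lagrangian[where m = m and mt = mt and F = F, OF assms(1) _ _ F]
  show "var_deriv (V \<alpha>) (formal_lagrangian m mt F) p = F \<alpha> p" if "\<alpha> \<in> {1..m}"
  proof -
    \<comment> \<open>The formula is proved on all of \<open>D\<close>, since total derivatives of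
      the terms with nonzero \<open>J\<close> can be discarded only if these vanish on an open
      set.\<close>
    have pd_V: "pd (Jet (V \<alpha>) J) (formal_lagrangian m mt F) q = (if J = (\<lambda>_. 0) then F \<alpha> q else 0)"
      if "q \<in> D" for J q
      using \<open>\<alpha> \<in> {1..m}\<close>
      by (subst pd_L[OF that orig(1)]) (auto simp: mult_delta_left)
    show ?thesis
      by (subst var_deriv_eq_pd[OF assms(1,3)]) (simp_all add: pd_V assms(3))
  qed
  show "var_deriv (Vt \<alpha>) (formal_lagrangian m mt F) p = (\<Sum>\<nu>=1..m. F \<nu> p)" if "\<alpha> \<in> {1..mt}"
  proof -
    have pd_Vt: "pd (Jet (Vt \<alpha>) J) (formal_lagrangian m mt F) q =
        (if J = (\<lambda>_. 0) then \<Sum>\<nu>=1..m. F \<nu> q else 0)"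
      if "q \<in> D" for J q
      using \<open>\<alpha> \<in> {1..mt}\<close>
      by (subst pd_L[OF that orig(2)]) auto
    show ?thesis
      by (subst var_deriv_eq_pd[OF assms(1,3)]) (simp_all add: pd_Vt assms(3))
  qed
qed

lemma differential_function_formal_lagrangian:
  fixes F :: "nat \<Rightarrow> 'n::finite jetfun"
  assumes "open D"
    and F: "\<And>\<alpha>. \<alpha> \<in> {1..m} \<Longrightarrow> differential_function D (orig_vars m mt) s (F \<alpha>)"
  shows "differential_function D (orig_vars m mt \<union> adj_vars m mt) s (formal_lagrangian m mt F)"
  unfolding differential_function_def
proof (intro conjI ballI impI)
  have "smooth_on D (F \<alpha>)" if "\<alpha> \<in> {1..m}" for \<alpha>
    using F[OF that] by (simp add: differential_function_def)
  then show "smooth_on D (formal_lagrangian m mt F)"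
    unfolding formal_lagrangian_def
    by (intro smooth_on_add smooth_on_mult smooth_on_sum smooth_on_coord assms(1))
next
  fix p q
  assume pq: "p \<in> D" "q \<in> D"
    and eq: "\<forall>c\<in>jet_coords (orig_vars m mt \<union> adj_vars m mt) s. p c = q c"
  have "F \<alpha> p = F \<alpha> q" if "\<alpha> \<in> {1..m}" for \<alpha>
  proof -
    have "\<forall>c\<in>jet_coords (orig_vars m mt) s. p c = q c"
      using eq by (auto simp: jet_coords_def)
    then show ?thesis
      using F[OF that] pq unfolding differential_function_def by blast
  qed
  \<comment> \<open>Undifferentiated variables have order 0, so their coordinates are among
    \<open>jet_coords\<close> for every \<open>s\<close>.\<close>
  moreover have "val z p = val z q" if "z \<in> adj_vars m mt" for z
    using that by (intro bspec[OF eq]) (auto simp: jet_coords_def mi_size_def)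
  ultimately show "formal_lagrangian m mt F p = formal_lagrangian m mt F q"
    by (simp add: formal_lagrangian_def adj_vars_def)
qed

text \<open>A solution is tested pointwise at its prolongation, which lies in \<open>D\<close>, so
  agreement of the equations on \<open>D\<close> also gives the same solutions.\<close>

lemma equivalent_systemsI:
  assumes "\<And>p. p \<in> D \<Longrightarrow> (\<forall>e\<in>E. e p = 0) \<longleftrightarrow> (\<forall>e\<in>E'. e p = 0)"
  shows "equivalent_systems D Z E E'"
  using assms unfolding equivalent_systems_def is_solution_def by blast

theorem theorem3p1:
  fixes m mt s :: nat
    and D :: "'n::{finite,linorder} jet set"
    and F :: "nat \<Rightarrow> 'n jetfun"
  assumes "open D"
    and "\<And>\<alpha>. \<alpha> \<in> {1..m} \<Longrightarrow> differential_function D (orig_vars m mt) s (F \<alpha>)"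
  shows "is_lagrangian_of D (orig_vars m mt \<union> adj_vars m mt)
    (\<lambda>p. (\<Sum>\<beta>=1..m. val (V \<beta>) p * F \<beta> p) + (\<Sum>\<beta>=1..mt. val (Vt \<beta>) p) * (\<Sum>\<nu>=1..m. F \<nu> p))
    (combined_system m mt F)"
proof -
  let ?L = "formal_lagrangian m mt F"
  let ?Z = "orig_vars m mt \<union> adj_vars m mt"
  have "equivalent_systems D ?Z (euler_lagrange ?Z ?L) (combined_system m mt F)"
  proof (rule equivalent_systemsI)
    fix p assume "p \<in> D"
    have V: "var_deriv (V \<alpha>) ?L p = F \<alpha> p" if "\<alpha> \<in> {1..m}" for \<alpha>
      using assms \<open>p \<in> D\<close> that by (rule var_deriv_V_formal_lagrangian)
    have Vt: "var_deriv (Vt \<alpha>) ?L p = (\<Sum>\<nu>=1..m. F \<nu> p)" if "\<alpha> \<in> {1..mt}" for \<alpha>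
      using assms \<open>p \<in> D\<close> that by (rule var_deriv_Vt_formal_lagrangian)
    have "(\<forall>e\<in>euler_lagrange ?Z ?L. e p = 0) \<longleftrightarrow> (\<forall>z\<in>?Z. var_deriv z ?L p = 0)"
      by (auto simp: euler_lagrange_def)
    also have "\<dots> \<longleftrightarrow>
        (\<forall>\<alpha>\<in>{1..m}. adj_F m mt F \<alpha> p = 0) \<and> (\<forall>\<alpha>\<in>{1..mt}. adj_Ft m mt F \<alpha> p = 0) \<and>
        (\<forall>\<alpha>\<in>{1..m}. F \<alpha> p = 0) \<and> (\<forall>\<alpha>\<in>{1..mt}. (\<Sum>\<nu>=1..m. F \<nu> p) = 0)"
      unfolding orig_vars_def adj_vars_def adj_F_def adj_Ft_def ball_Un ball_simps
      using V Vt by simp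
    \<comment> \<open>The last block follows from \<open>F \<alpha> p = 0\<close> for all
      \<open>\<alpha>\<close>, which the \<open>V\<close> equations supply; it is empty if
      \<open>mt = 0\<close>.\<close>
    also have "\<dots> \<longleftrightarrow> (\<forall>e\<in>combined_system m mt F. e p = 0)"
      unfolding combined_system_def ball_Un by auto
    finally show "(\<forall>e\<in>euler_lagrange ?Z ?L. e p = 0) \<longleftrightarrow>
      (\<forall>e\<in>combined_system m mt F. e p = 0)" .
  qed
  moreover have "differential_function D ?Z s ?L"
    using assms by (rule differential_function_formal_lagrangian)
  ultimately have "is_lagrangian_of D ?Z ?L (combined_system m mt F)"
    unfolding is_lagrangian_of_def by blast
  then show ?thesis
    unfolding formal_lagrangian_def .
qed

end
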